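(* Let $X$ be a Lévy process. The starting point $0$ of $X$ is regular for the half-line $(0,\infty)$ if and only if $$\int_0^1 t^{-1}\,\mathbb{P}(X_t>0)\,\mathrm{d}t=\infty.$$
   Context: A Lévy process $X=(X_t)_{t\ge0}$ is real-valued with stationary independent increments and càdlàg paths, started at zero; it is assumed not identically equal to zero. $0$ is called regular for $(0,\infty)$ if $X$ visits $(0,\infty)$ almost surely immediately after time $0$, i.e. $\mathbb{P}\big(\bigcap_{t>0}\bigcup_{s\le t}\{X_s>0\}\big)=1$. *)

theory Defs
  imports "HOL-Probability.Probability"
begin

definition cadlag :: "(real \<Rightarrow> real) \<Rightarrow> bool" where
  "cadlag f \<longleftrightarrow>
     (\<forall>t\<ge>0. (f \<longlongrightarrow> f t) (at_right t)) \<and>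
     (\<forall>t>0. \<exists>l. (f \<longlongrightarrow> l) (at_left t))"

text \<open>Time is the half-line \<open>t \<ge> 0\<close> inside \<^typ>\<open>real\<close>; the values of \<open>X\<close> at negative
  times are unconstrained. The increments are taken along an arbitrary partition
  \<open>0 \<le> t 0 \<le> t 1 \<le> \<dots> \<le> t n\<close>.
  The assumption \<open>not_zero\<close> excludes processes that vanish identically up to a null set.\<close>

locale levy_process = prob_space M for M :: "'a measure" +
  fixes X :: "real \<Rightarrow> 'a \<Rightarrow> real"
  assumes rv: "\<And>t. t \<ge> 0 \<Longrightarrow> random_variable borel (X t)"
    and start_zero: "\<And>\<omega>. \<omega> \<in> space M \<Longrightarrow> X 0 \<omega> = 0"
    and stationary_increments:
      "\<And>s h. s \<ge> 0 \<Longrightarrow> h \<ge> 0 \<Longrightarrow>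
         distr M borel (\<lambda>\<omega>. X (s + h) \<omega> - X s \<omega>) = distr M borel (\<lambda>\<omega>. X h \<omega> - X 0 \<omega>)"
    and independent_increments:
      "\<And>(t :: nat \<Rightarrow> real) n. 0 \<le> t 0 \<Longrightarrow> (\<And>i. i < n \<Longrightarrow> t i \<le> t (Suc i)) \<Longrightarrow>
         indep_vars (\<lambda>_. borel) (\<lambda>i \<omega>. X (t (Suc i)) \<omega> - X (t i) \<omega>) {..<n}"
    and cadlag_paths: "\<And>\<omega>. \<omega> \<in> space M \<Longrightarrow> cadlag (\<lambda>t. X t \<omega>)"
    and not_zero: "\<not> (AE \<omega> in M. \<forall>t\<ge>0. X t \<omega> = 0)"

text \<open>For a process with right-continuous paths the event below is measurable, since the
  unions and intersections may then be restricted to rational times.\<close>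

definition regular_for_positive_half_line :: "'a measure \<Rightarrow> (real \<Rightarrow> 'a \<Rightarrow> real) \<Rightarrow> bool" where
  "regular_for_positive_half_line M X \<longleftrightarrow>
     measure M (\<Inter>t\<in>{0<..}. \<Union>s\<in>{0..t}. {\<omega> \<in> space M. X s \<omega> > 0}) = 1"

end

theory Submission
  imports Defs
begin

text \<open>
  Write \<open>p t = P (X t > 0)\<close>. The criterion is obtained by observing the process on the grids
  \<open>h, 2 h, 3 h, \<dots>\<close>, where it is a random walk, and by averaging over the mesh \<open>h\<close>.

  For a random walk \<open>S\<close> with first passage time \<open>\<tau>\<close> into the positive half-line, the theorem of
  Sparre Andersen says that \<open>1 - E q\<^sup>\<tau> = exp (- (\<Sum>n\<ge>1. q\<^sup>n / n * P (S n > 0)))\<close>. It is used here in the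
  logarithmic form \<open>(\<Sum>n\<ge>1. q\<^sup>n / n * P (S n > 0)) = (\<Sum>r\<ge>1. (E q\<^sup>\<tau>)\<^sup>r / r)\<close> (\<open>sparre_andersen\<close>), which makes
  sense in \<open>[0, \<infinity>]\<close> and follows from two facts. A path of length \<open>n\<close> that ends above \<open>0\<close> has, among its
  \<open>n\<close> cyclic rearrangements, as many for which \<open>n\<close> is a strict ladder epoch as each of those has
  ladder epochs altogether (\<open>sum_rotations_ladder\<close>), so that \<open>P (S n > 0) / n\<close> is the sum of
  \<open>P (n is the r-th ladder epoch) / r\<close> over \<open>r\<close>. And the walk starts afresh at each ladder epoch, so
  that the \<open>r\<close>-th one has the transform \<open>(E q\<^sup>\<tau>)\<^sup>r\<close> (\<open>nn_integral_ladder_transform\<close>).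

  With \<open>q = exp (- h)\<close> the left-hand side becomes the series \<open>\<Sum>n\<ge>1. exp (- n h) p (n h) / n\<close>, which looks
  like a Riemann sum for \<open>\<integral> exp (- t) p t / t dt\<close>. But \<open>p\<close> may be discontinuous, so
  convergence as \<open>h \<rightarrow> 0\<close> is not clear. The mean value of the series over \<open>0 < h \<le> \<delta>\<close>, on the other hand, can be
  computed exactly: it is the integral of \<open>exp (- t) p t\<close> against a weight that lies between
  \<open>1 / (t + \<delta>)\<close> and \<open>2 / t\<close> (\<open>average_grid_series\<close>, \<open>grid_weight_bounds\<close>).

  If \<open>0\<close> is regular, right continuity makes the first passage time on the grid tend to \<open>0\<close> almost
  surely, so \<open>E q\<^sup>\<tau> \<rightarrow> 1\<close>, the series tends to \<open>\<infinity>\<close> as \<open>h \<rightarrow> 0\<close>, and so do its means by Fatou's lemma; the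
  upper bound on the weight makes the integral infinite. If \<open>0\<close> is not regular, then with a positive
  probability the process stays out of \<open>(0, \<infinity>)\<close> up to some fixed time, hence also on every grid; this keeps
  \<open>E q\<^sup>\<tau>\<close> below a constant less than \<open>1\<close> for all meshes at once, the series stays bounded, and the
  lower bound on the weight makes the integral finite.
\<close>

section \<open>Ladder epochs and cyclic rearrangements\<close>

definition psum :: "(nat \<Rightarrow> real) \<Rightarrow> nat \<Rightarrow> real" where
  "psum y n = (\<Sum>i<n. y i)"

definition ladder :: "(nat \<Rightarrow> real) \<Rightarrow> nat \<Rightarrow> bool" where
  "ladder y n \<longleftrightarrow> (\<forall>i<n. psum y i < psum y n)"

definition ladder_count :: "(nat \<Rightarrow> real) \<Rightarrow> nat \<Rightarrow> nat" where
  "ladder_count y n = card {k \<in> {1..n}. ladder y k}"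

definition first_passage :: "(nat \<Rightarrow> real) \<Rightarrow> nat \<Rightarrow> bool" where
  "first_passage y k \<longleftrightarrow> k > 0 \<and> psum y k > 0 \<and> (\<forall>i\<in>{0<..<k}. psum y i \<le> 0)"

text \<open>The index map is defined on all of \<open>nat\<close>, with the identity beyond \<open>n\<close>, so that it acts on
  infinite step sequences and leaves their product law invariant.\<close>

definition cyclic_index :: "nat \<Rightarrow> nat \<Rightarrow> nat \<Rightarrow> nat" where
  "cyclic_index n j i = (if i < n then (i + j) mod n else i)"

lemma card_periodic_window:
  fixes n :: nat
  assumes "\<And>m. m + n \<in> R \<longleftrightarrow> m \<in> R"
  shows "card (R \<inter> {j..<j + n}) = card (R \<inter> {..<n})"
proof (induction j)
  case 0
  show ?case by (simp add: atLeast0LessThan)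
next
  case (Suc j)
  have 1: "insert j {Suc j..<j + Suc n} = {j..<j + Suc n}" "insert (j + n) {j..<j + n} = {j..<j + Suc n}"
    by auto
  have "card (R \<inter> {Suc j..<Suc j + n}) + of_bool (j \<in> R) = card (R \<inter> insert j {Suc j..<j + Suc n})"
    by simp
  also have "\<dots> = card (R \<inter> insert (j + n) {j..<j + n})"
    unfolding 1 ..
  also have "\<dots> = card (R \<inter> {j..<j + n}) + of_bool (j \<in> R)"
    using assms[of j] by simp
  finally show ?case using Suc by simp
qed

lemma psum_add: "psum y (m + n) = psum y m + psum (\<lambda>i. y (m + i)) n"
  by (induction n) (simp_all add: psum_def)

text \<open>Extend the first \<open>n\<close> steps periodically; the partial sums \<open>P\<close> of the extension satisfy
  \<open>P (m + n) = P m + P n\<close>. That \<open>n\<close> is a ladder epoch of the rearrangement starting at \<open>j\<close> says that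
  \<open>P (j + n)\<close> exceeds the \<open>n\<close> values before it. The set \<open>R\<close> of these \<open>j\<close> has period \<open>n\<close>, and from a
  starting point \<open>j \<in> R\<close> the ladder epochs up to \<open>n\<close> are exactly the \<open>i\<close> with \<open>j + i \<in> R\<close>.
  Hence each nonzero summand is the reciprocal of the number of nonzero summands, and it remains to see that
  \<open>R\<close> is nonempty exactly when \<open>P n > 0\<close>.\<close>

lemma sum_rotations_ladder:
  assumes "n > 0"
  shows "(\<Sum>j<n. of_bool (ladder (y \<circ> cyclic_index n j) n) / real (ladder_count (y \<circ> cyclic_index n j) n))
       = of_bool (psum y n > 0)"
proof -
  define z where "z i = y (i mod n)" for i
  define P where "P = psum z"
  define R where "R = {m. \<forall>i<n. P (m + i) < P (m + n)}"
  have Pn: "P n = psum y n"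
    unfolding P_def psum_def by (intro sum.cong) (auto simp: z_def)
  have z_per: "z (n + i) = z i" for i
    by (simp add: z_def)
  have per: "P (m + n) = P m + psum y n" for m
    unfolding P_def add.commute[of m n] psum_add z_per using Pn unfolding P_def by simp
  have rot: "psum (y \<circ> cyclic_index n j) i = P (j + i) - P j" if "i \<le> n" for i j
  proof -
    have "psum (y \<circ> cyclic_index n j) i = psum (\<lambda>i. z (j + i)) i"
      unfolding psum_def using that
      by (intro sum.cong) (auto simp: cyclic_index_def z_def add.commute)
    thus ?thesis by (simp add: P_def psum_add)
  qed
  have lad: "ladder (y \<circ> cyclic_index n j) i \<longleftrightarrow> (\<forall>l<i. P (j + l) < P (j + i))" if "i \<le> n" for i j
    using that unfolding ladder_def by (auto simp: rot)
  have R_per: "m + n \<in> R \<longleftrightarrow> m \<in> R" for m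
  proof -
    have "P (m + n + i) = P (m + i) + psum y n" for i
      using per[of "m + i"] by (simp add: ac_simps)
    thus ?thesis by (simp add: R_def)
  qed
  have lad_n: "ladder (y \<circ> cyclic_index n j) n \<longleftrightarrow> j \<in> R" for j
    by (simp add: lad R_def)
  have lad_i: "ladder (y \<circ> cyclic_index n j) i \<longleftrightarrow> j + i \<in> R" if j: "j \<in> R" and i: "i \<in> {1..n}" for i j
  proof
    assume L: "ladder (y \<circ> cyclic_index n j) i"
    have L': "P (j + l) < P (j + i)" if "l < i" for l
      using L i that by (auto simp: lad)
    have "P (j + i + l) < P (j + i + n)" if l: "l < n" for l
    proof (cases "n \<le> i + l")
      case True
      have "P (j + i + l) = P (j + (i + l - n)) + psum y n"
        using per[of "j + (i + l - n)"] True by (simp add: ac_simps)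
      thus ?thesis using L'[of "i + l - n"] l True i by (simp add: per)
    next
      case False
      have "P (j + (i + l)) < P (j + n)"
        using j False unfolding R_def by auto
      also have "\<dots> < P (j + i + n)"
        using L'[of 0] i by (simp add: per)
      finally show ?thesis by (simp add: ac_simps)
    qed
    thus "j + i \<in> R" by (simp add: R_def)
  next
    assume "j + i \<in> R"
    hence R: "P (j + i + l) < P (j + i) + psum y n" if "l < n" for l
      using that unfolding R_def by (auto simp: per)
    have "P (j + l) < P (j + i)" if l: "l < i" for l
    proof -
      have "P (j + i + (n + l - i)) = P (j + l) + psum y n"
        using per[of "j + l"] l i by (simp add: ac_simps)
      thus ?thesis using R[of "n + l - i"] l i by auto
    qed
    thus "ladder (y \<circ> cyclic_index n j) i"
      using i by (simp add: lad)
  qed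
  have count: "ladder_count (y \<circ> cyclic_index n j) n = card (R \<inter> {..<n})" if j: "j \<in> R" for j
  proof -
    have "card {k \<in> {1..n}. ladder (y \<circ> cyclic_index n j) k} = card {k \<in> {1..n}. j + k \<in> R}"
      using lad_i[OF j] by (intro arg_cong[where f = card]) auto
    also have "\<dots> = card ((+) j ` {k \<in> {1..n}. j + k \<in> R})"
      by (rule card_image[symmetric]) auto
    also have "(+) j ` {k \<in> {1..n}. j + k \<in> R} = R \<inter> {Suc j..<Suc j + n}"
    proof (intro set_eqI iffI)
      fix m assume "m \<in> R \<inter> {Suc j..<Suc j + n}"
      thus "m \<in> (+) j ` {k \<in> {1..n}. j + k \<in> R}"
        by (intro image_eqI[where x = "m - j"]) auto
    qed auto
    also have "card \<dots> = card (R \<inter> {..<n})"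
      by (rule card_periodic_window[OF R_per])
    finally show ?thesis unfolding ladder_count_def .
  qed
  have "(\<Sum>j<n. of_bool (ladder (y \<circ> cyclic_index n j) n) / real (ladder_count (y \<circ> cyclic_index n j) n))
      = (\<Sum>j<n. of_bool (j \<in> R) / real (card (R \<inter> {..<n})))"
    by (intro sum.cong) (auto simp: lad_n count)
  also have "\<dots> = real (card (R \<inter> {..<n})) / real (card (R \<inter> {..<n}))"
    by (simp add: sum_divide_distrib[symmetric] sum.If_cases of_bool_def Int_commute Collect_mem_eq)
  also have "\<dots> = of_bool (psum y n > 0)"
  proof (cases "psum y n > 0")
    case True
    \<comment> \<open>The first maximiser of \<open>P\<close> over one period exceeds the \<open>n\<close> values before it: those in the same
      period by minimality, the others because they are raised by \<open>P n > 0\<close> when moved into that period.\<close>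
    define V where "V = Max (P ` {n..<n + n})"
    define m where "m = (LEAST m. m \<in> {n..<n + n} \<and> P m = V)"
    have "V \<in> P ` {n..<n + n}"
      unfolding V_def using assms by (intro Max_in) auto
    hence "\<exists>m. m \<in> {n..<n + n} \<and> P m = V" by auto
    from LeastI_ex[OF this] have m: "m \<in> {n..<n + n}" "P m = V"
      unfolding m_def by auto
    have le: "P i \<le> P m" if "i \<in> {n..<n + n}" for i
      unfolding m(2) V_def using that by (intro Max_ge) auto
    have less: "P i < P m" if "i \<in> {n..<m}" for i
    proof -
      have "P i \<noteq> V"
        using not_less_Least[of i "\<lambda>m. m \<in> {n..<n + n} \<and> P m = V"] that m unfolding m_def[symmetric] by auto
      thus ?thesis using le[of i] that m by auto
    qed
    have "P (m - n + i) < P m" if "i < n" for i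
    proof (cases "n \<le> m - n + i")
      case True
      thus ?thesis using that m by (intro less) auto
    next
      case False
      have "P (m - n + i) < P (m - n + i + n)"
        using True by (simp only: per)
      also have "\<dots> \<le> P m"
        using False m by (intro le) auto
      finally show ?thesis .
    qed
    hence "m - n \<in> R \<inter> {..<n}"
      using m by (auto simp: R_def)
    hence "card (R \<inter> {..<n}) \<noteq> 0" by auto
    thus ?thesis using True by simp
  next
    case False
    have "m \<notin> R" for m
      using False assms unfolding R_def by (auto simp: per intro!: exI[of _ 0])
    hence "R = {}" by auto
    thus ?thesis using False by simp
  qed
  finally show ?thesis .
qed

text \<open>The first passage time is the first ladder epoch, and before it the path is at most \<open>0\<close>.
  The later records of the path are therefore the records of the path restarted at that time.\<close>

lemma ladder_after_first_passage:
  assumes k: "first_passage y k"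
  shows "ladder y (k + n) \<longleftrightarrow> ladder (\<lambda>i. y (k + i)) n"
    and "ladder_count y (k + n) = Suc (ladder_count (\<lambda>i. y (k + i)) n)"
proof -
  have le0: "psum y i \<le> 0" if "i < k" for i
    using k that by (cases "i = 0") (auto simp: first_passage_def psum_def)
  show *: "ladder y (k + n) \<longleftrightarrow> ladder (\<lambda>i. y (k + i)) n" for n
  proof
    assume "ladder y (k + n)"
    thus "ladder (\<lambda>i. y (k + i)) n"
      unfolding ladder_def by (metis add_less_cancel_left psum_add)
  next
    assume L: "ladder (\<lambda>i. y (k + i)) n"
    have "psum y i < psum y (k + n)" if "i < k + n" for i
    proof (cases "i < k")
      case True
      have "psum (\<lambda>i. y (k + i)) n \<ge> 0"
        using L unfolding ladder_def by (cases "n = 0") (auto simp: psum_def dest!: spec[of _ 0])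
      thus ?thesis using le0[OF True] k unfolding psum_add first_passage_def by auto
    next
      case False
      then obtain l where l: "i = k + l" by (metis le_Suc_ex not_less)
      show ?thesis using L that unfolding l psum_add ladder_def by auto
    qed
    thus "ladder y (k + n)" by (simp add: ladder_def)
  qed
  have k0: "k > 0" "psum y k > 0" using k by (auto simp: first_passage_def)
  have "ladder y k"
    using *[of 0] by (simp add: ladder_def)
  moreover have "\<not> ladder y i" if "0 < i" "i < k" for i
    using le0[of i] that unfolding ladder_def by (auto intro!: exI[of _ 0] simp: psum_def)
  ultimately have eq: "{i \<in> {1..k + n}. ladder y i} = insert k ((+) k ` {i \<in> {1..n}. ladder (\<lambda>i. y (k + i)) i})"
  proof (intro set_eqI iffI, goal_cases)
    case (1 i)
    have "i \<ge> k" using 1 by (auto simp: not_less[symmetric])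
    then obtain l where "i = k + l" by (metis le_Suc_ex)
    thus ?case using 1 by (cases "l = 0") (auto simp: *)
  next
    case (2 i)
    thus ?case using k0 by (auto simp: *)
  qed
  show "ladder_count y (k + n) = Suc (ladder_count (\<lambda>i. y (k + i)) n)"
    unfolding ladder_count_def eq by (subst card_insert_disjoint) (auto simp: card_image)
qed

lemma first_passage_unique:
  assumes "first_passage y k" "first_passage y l"
  shows "k = l"
proof (rule ccontr)
  assume "k \<noteq> l"
  hence "k < l \<or> l < k" by auto
  moreover have False if "first_passage y k" "first_passage y l" "k < l" for k l
  proof -
    have "psum y k \<le> 0" using that by (auto simp: first_passage_def)
    thus False using that by (auto simp: first_passage_def)
  qed
  ultimately show False using assms by blast
qed

lemma first_passage_exists:
  assumes "psum y n > 0"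
  shows "\<exists>k\<le>n. first_passage y k"
proof -
  let ?k = "LEAST k. psum y k > 0"
  have 1: "psum y ?k > 0" using assms by (rule LeastI)
  moreover have "?k \<le> n" using assms by (rule Least_le)
  moreover have "psum y i \<le> 0" if "i < ?k" for i
    using not_less_Least[OF that] by simp
  moreover have "?k > 0" using 1 by (intro gr0I) (simp add: psum_def)
  ultimately show ?thesis unfolding first_passage_def by auto
qed

lemma ladder_count_zero_iff:
  assumes "ladder y n"
  shows "ladder_count y n = 0 \<longleftrightarrow> n = 0"
proof -
  have "n = 0" if "ladder_count y n = 0"
  proof (rule ccontr)
    assume "n \<noteq> 0"
    hence "n \<in> {k \<in> {1..n}. ladder y k}" using assms by auto
    thus False using that unfolding ladder_count_def by (subst (asm) card_eq_0_iff) auto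
  qed
  thus ?thesis by (auto simp: ladder_count_def)
qed

section \<open>Transforms of ladder epochs\<close>

lemma measurable_psum [measurable]:
  "(\<lambda>y. psum y n) \<in> borel_measurable (\<Pi>\<^sub>M i\<in>(UNIV::nat set). (borel :: real measure))"
  unfolding psum_def by measurable

lemma pred_ladder [measurable]:
  "Measurable.pred (\<Pi>\<^sub>M i\<in>(UNIV::nat set). (borel :: real measure)) (\<lambda>y. ladder y n)"
  unfolding ladder_def by measurable

lemma pred_first_passage [measurable]:
  "Measurable.pred (\<Pi>\<^sub>M i\<in>(UNIV::nat set). (borel :: real measure)) (\<lambda>y. first_passage y n)"
  unfolding first_passage_def by measurable

lemma measurable_ladder_count [measurable]:
  "(\<lambda>y. ladder_count y n) \<in> measurable (\<Pi>\<^sub>M i\<in>(UNIV::nat set). (borel :: real measure)) (count_space UNIV)"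
  unfolding ladder_count_def by measurable

lemma measurable_reindex:
  "(\<lambda>y i. y (\<pi> i)) \<in> measurable (\<Pi>\<^sub>M i\<in>UNIV. M) (\<Pi>\<^sub>M i\<in>UNIV. M)"
  by (rule measurable_PiM_single') (auto simp: space_PiM PiE_def)

text \<open>At most one summand is nonzero: the value is \<open>q ^ T\<close> for the \<open>r\<close>-th ladder epoch \<open>T\<close>, and \<open>0\<close> if
  there are fewer than \<open>r\<close> of them. The series form makes measurability and Fubini immediate.\<close>

definition ladder_transform :: "real \<Rightarrow> nat \<Rightarrow> (nat \<Rightarrow> real) \<Rightarrow> ennreal" where
  "ladder_transform q r y = (\<Sum>n. if ladder y n \<and> ladder_count y n = r then ennreal (q ^ n) else 0)"

definition passage_transform :: "real \<Rightarrow> (nat \<Rightarrow> real) \<Rightarrow> ennreal" where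
  "passage_transform q y = (\<Sum>n. if first_passage y n then ennreal (q ^ n) else 0)"

lemma suminf_single_ennreal:
  fixes f :: "nat \<Rightarrow> ennreal"
  assumes "\<And>n. n \<noteq> k \<Longrightarrow> f n = 0"
  shows "(\<Sum>n. f n) = f k"
  using suminf_finite[of "{k}" f] assms by auto

lemma passage_transform_eq:
  "first_passage y k \<Longrightarrow> passage_transform q y = ennreal (q ^ k)"
  unfolding passage_transform_def
  by (subst suminf_single_ennreal[of k]) (auto dest: first_passage_unique)

lemma ladder_transform_0: "ladder_transform q 0 y = 1"
  unfolding ladder_transform_def
  by (subst suminf_single_ennreal[of 0]) (auto simp: ladder_count_zero_iff ladder_def ladder_count_def)

text \<open>Restart the path at its first ladder epoch \<open>k\<close>: its \<open>(r + 1)\<close>-st ladder epoch is \<open>k\<close> plus the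
  \<open>r\<close>-th ladder epoch of the remaining path.\<close>

lemma ladder_transform_Suc:
  assumes "q \<ge> 0"
  shows "ladder_transform q (Suc r) y =
    (\<Sum>k. if first_passage y k then ennreal (q ^ k) * ladder_transform q r (\<lambda>i. y (k + i)) else 0)"
proof (cases "\<exists>k. first_passage y k")
  case True
  then obtain k where k: "first_passage y k" ..
  let ?f = "\<lambda>n. if ladder y n \<and> ladder_count y n = Suc r then ennreal (q ^ n) else 0"
  have "?f n = 0" if "n < k" for n
  proof -
    have "\<not> ladder y n" if "n \<noteq> 0"
    proof
      assume "ladder y n"
      hence "psum y n > 0" using that by (auto simp: ladder_def psum_def dest!: spec[of _ 0])
      thus False using k \<open>n < k\<close> that by (auto simp: first_passage_def not_less[symmetric])
    qed
    thus ?thesis by (cases "n = 0") (auto simp: ladder_count_def)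
  qed
  hence "ladder_transform q (Suc r) y = (\<Sum>n. ?f (n + k))"
    unfolding ladder_transform_def by (subst suminf_offset[of _ k]) auto
  also have "\<dots> = (\<Sum>n. ennreal (q ^ k) *
      (if ladder (\<lambda>i. y (k + i)) n \<and> ladder_count (\<lambda>i. y (k + i)) n = r then ennreal (q ^ n) else 0))"
    using assms
    by (intro suminf_cong)
      (auto simp: ladder_after_first_passage[OF k] add.commute[of _ k] power_add ennreal_mult)
  also have "\<dots> = ennreal (q ^ k) * ladder_transform q r (\<lambda>i. y (k + i))"
    unfolding ladder_transform_def by (simp add: ennreal_suminf_cmult)
  also have "\<dots> = (\<Sum>k. if first_passage y k then ennreal (q ^ k) * ladder_transform q r (\<lambda>i. y (k + i)) else 0)"
    using k by (subst suminf_single_ennreal[of k]) (auto dest: first_passage_unique)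
  finally show ?thesis .
next
  case False
  hence "psum y n \<le> 0" for n
    using first_passage_exists[of y n] by (auto simp: not_less[symmetric])
  hence "\<not> ladder y n" if "n \<noteq> 0" for n
    using that by (auto simp: ladder_def psum_def not_less intro!: exI[of _ 0])
  hence "(if ladder y n \<and> ladder_count y n = Suc r then ennreal (q ^ n) else 0) = 0" for n
    by (cases "n = 0") (auto simp: ladder_count_def)
  thus ?thesis using False unfolding ladder_transform_def by simp
qed

lemma first_passage_cong:
  assumes "\<And>i. i < k \<Longrightarrow> y i = z i"
  shows "first_passage y k \<longleftrightarrow> first_passage z k"
proof -
  have "psum y i = psum z i" if "i \<le> k" for i
    unfolding psum_def using assms that by (intro sum.cong) auto
  thus ?thesis unfolding first_passage_def by auto
qed

lemma measurable_ladder_transform [measurable]: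
  "ladder_transform q r \<in> borel_measurable (\<Pi>\<^sub>M i\<in>(UNIV::nat set). (borel :: real measure))"
  unfolding ladder_transform_def[abs_def] by measurable

lemma measurable_passage_transform [measurable]:
  "passage_transform q \<in> borel_measurable (\<Pi>\<^sub>M i\<in>(UNIV::nat set). (borel :: real measure))"
  unfolding passage_transform_def[abs_def] by measurable

lemma passage_transform_le:
  assumes "0 \<le> q" "q \<le> 1" "\<And>n. first_passage y n \<Longrightarrow> m \<le> n"
  shows "passage_transform q y \<le> ennreal (q ^ m)"
proof (cases "\<exists>k. first_passage y k")
  case True
  then obtain k where k: "first_passage y k" ..
  show ?thesis
    unfolding passage_transform_eq[OF k] using assms k by (intro ennreal_leI power_decreasing) auto
next
  case False
  thus ?thesis by (simp add: passage_transform_def)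
qed

section \<open>Sparre Andersen's identity for random walks\<close>

locale random_walk = sequence_space \<mu> for \<mu> :: "real measure" +
  assumes sets_mu [measurable_cong]: "sets \<mu> = sets borel"
begin

lemma sets_S [measurable_cong]: "sets S = sets (\<Pi>\<^sub>M i\<in>(UNIV::nat set). (borel :: real measure))"
  by (intro sets_PiM_cong) (auto simp: sets_mu)

lemma nn_integral_reindex:
  assumes "f \<in> borel_measurable S" "inj \<pi>"
  shows "(\<integral>\<^sup>+y. f (y \<circ> \<pi>) \<partial>S) = (\<integral>\<^sup>+y. f y \<partial>S)"
proof -
  have *: "distr S S (\<lambda>y. y \<circ> \<pi>) = S"
    using distr_PiM_reindex[of UNIV "\<lambda>_. \<mu>" \<pi> UNIV] assms(2) M.prob_space_axioms
    by (simp add: restrict_UNIV comp_def)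
  have [measurable]: "(\<lambda>y. y \<circ> \<pi>) \<in> measurable S S"
    unfolding comp_def by (rule measurable_reindex)
  show ?thesis
    using assms by (subst (2) *[symmetric]) (simp add: nn_integral_distr)
qed

lemma inj_cyclic_index: "inj (cyclic_index n j)"
proof -
  have False if "cyclic_index n j a = cyclic_index n j b" "a < b" for a b
  proof (cases "b < n")
    case True
    hence "(b + j) mod n = (a + j) mod n"
      using that by (simp add: cyclic_index_def)
    hence "n dvd (b + j) - (a + j)"
      using that by (subst (asm) mod_eq_dvd_iff_nat) auto
    hence "n \<le> b - a" using that by (intro dvd_imp_le) auto
    thus False using True by linarith
  next
    case False
    have "cyclic_index n j a < b"
      using False that by (cases "a < n") (auto simp: cyclic_index_def intro: less_le_trans[of _ n])
    thus False
      using False that by (simp add: cyclic_index_def)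
  qed
  thus ?thesis by (intro injI) (metis linorder_cases)
qed

text \<open>The law of the steps is invariant under cyclic rearrangement, so the expectation on the left is \<open>1 / n\<close>
  times the expectation of the sum over all rearrangements.\<close>

lemma sparre_andersen_expectation:
  assumes "n > 0"
  shows "(\<integral>\<^sup>+y. ennreal (of_bool (ladder y n) / real (ladder_count y n)) \<partial>S)
       = ennreal (1 / real n) * emeasure S {y \<in> space S. psum y n > 0}"
proof -
  let ?g = "\<lambda>y. ennreal (of_bool (ladder y n) / real (ladder_count y n))"
  have g: "?g \<in> borel_measurable S" by measurable
  have g': "(\<lambda>y. ?g (y \<circ> cyclic_index n j)) \<in> borel_measurable S" for j
    unfolding comp_def by (rule measurable_compose[OF measurable_reindex g])
  have "(\<integral>\<^sup>+y. ?g (y \<circ> cyclic_index n j) \<partial>S) = (\<integral>\<^sup>+y. ?g y \<partial>S)" for j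
    by (rule nn_integral_reindex[OF g inj_cyclic_index])
  hence "of_nat n * (\<integral>\<^sup>+y. ?g y \<partial>S) = (\<Sum>j<n. \<integral>\<^sup>+y. ?g (y \<circ> cyclic_index n j) \<partial>S)"
    by simp
  also have "\<dots> = (\<integral>\<^sup>+y. (\<Sum>j<n. ?g (y \<circ> cyclic_index n j)) \<partial>S)"
    by (rule nn_integral_sum[symmetric]) (rule g')
  also have "\<dots> = (\<integral>\<^sup>+y. indicator {y \<in> space S. psum y n > 0} y \<partial>S)"
    using assms
    by (intro nn_integral_cong) (auto simp: sum_ennreal sum_rotations_ladder indicator_def)
  also have "\<dots> = emeasure S {y \<in> space S. psum y n > 0}"
    by (rule nn_integral_indicator) measurable
  finally have *: "of_nat n * (\<integral>\<^sup>+y. ?g y \<partial>S) = emeasure S {y \<in> space S. psum y n > 0}" .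
  have "ennreal (1 / real n) * of_nat n = 1"
    using assms by (simp add: ennreal_of_nat_eq_real_of_nat ennreal_mult[symmetric])
  thus ?thesis unfolding *[symmetric] mult.assoc[symmetric] by simp
qed

text \<open>This is the strong Markov property at the first passage time: the event that it equals \<open>k\<close>
  depends on the first \<open>k\<close> steps only, and the steps after \<open>k\<close> are independent of them with the same
  law. Splitting a sequence at \<open>k\<close> by \<open>comb_seq\<close> expresses this as an iterated integral.\<close>

lemma nn_integral_ladder_transform:
  assumes "q \<ge> 0"
  shows "(\<integral>\<^sup>+y. ladder_transform q r y \<partial>S) = (\<integral>\<^sup>+y. passage_transform q y \<partial>S) ^ r"
proof (induction r)
  case 0
  show ?case by (simp add: ladder_transform_0 P.emeasure_space_1)
next
  case (Suc r)
  have meas: "(\<lambda>y. if first_passage y k then ennreal (q ^ k) * ladder_transform q r (\<lambda>i. y (k + i)) else 0)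
    \<in> borel_measurable S" for k
  proof -
    have [measurable]: "(\<lambda>y. ladder_transform q r (\<lambda>i. y (k + i))) \<in> borel_measurable S"
      by (rule measurable_compose[OF measurable_reindex]) measurable
    show ?thesis by measurable
  qed
  have split: "(\<integral>\<^sup>+y. f y \<partial>S) = (\<integral>\<^sup>+y. \<integral>\<^sup>+z. f (comb_seq k y z) \<partial>S \<partial>S)" if [measurable]: "f \<in> borel_measurable S" for f k
  proof -
    have "(\<integral>\<^sup>+y. f y \<partial>S) = (\<integral>\<^sup>+p. f (case p of (y, z) \<Rightarrow> comb_seq k y z) \<partial>(S \<Otimes>\<^sub>M S))"
      by (subst PiM_comb_seq[of k, symmetric], subst nn_integral_distr) (auto intro: measurable_comb_seq)
    thus ?thesis
      by (subst (asm) P.nn_integral_fst[symmetric]) (auto simp: split_beta')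
  qed
  have "(\<integral>\<^sup>+y. ladder_transform q (Suc r) y \<partial>S) =
      (\<integral>\<^sup>+y. (\<Sum>k. if first_passage y k then ennreal (q ^ k) * ladder_transform q r (\<lambda>i. y (k + i)) else 0) \<partial>S)"
    using assms by (simp add: ladder_transform_Suc)
  also have "\<dots> = (\<Sum>k. \<integral>\<^sup>+y. (if first_passage y k then ennreal (q ^ k) * ladder_transform q r (\<lambda>i. y (k + i)) else 0) \<partial>S)"
    by (rule nn_integral_suminf) (rule meas)
  also have "\<dots> = (\<Sum>k. \<integral>\<^sup>+y. (if first_passage y k then ennreal (q ^ k) else 0) * (\<integral>\<^sup>+z. ladder_transform q r z \<partial>S) \<partial>S)"
  proof (rule suminf_cong)
    fix k
    have "(\<integral>\<^sup>+y. (if first_passage y k then ennreal (q ^ k) * ladder_transform q r (\<lambda>i. y (k + i)) else 0) \<partial>S)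
      = (\<integral>\<^sup>+y. \<integral>\<^sup>+z. (if first_passage (comb_seq k y z) k then ennreal (q ^ k) * ladder_transform q r (\<lambda>i. comb_seq k y z (k + i)) else 0) \<partial>S \<partial>S)"
      by (rule split) (rule meas)
    also have "\<dots> = (\<integral>\<^sup>+y. \<integral>\<^sup>+z. (if first_passage y k then ennreal (q ^ k) else 0) * ladder_transform q r z \<partial>S \<partial>S)"
    proof (intro nn_integral_cong, goal_cases)
      case (1 y z)
      have "first_passage (comb_seq k y z) k \<longleftrightarrow> first_passage y k"
        by (rule first_passage_cong) (simp add: comb_seq_less)
      moreover have "(\<lambda>i. comb_seq k y z (k + i)) = z"
        by (simp add: comb_seq_def)
      ultimately show ?case by simp
    qed
    also have "\<dots> = (\<integral>\<^sup>+y. (if first_passage y k then ennreal (q ^ k) else 0) * (\<integral>\<^sup>+z. ladder_transform q r z \<partial>S) \<partial>S)"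
      by (intro nn_integral_cong nn_integral_cmult) measurable
    finally show "(\<integral>\<^sup>+y. (if first_passage y k then ennreal (q ^ k) * ladder_transform q r (\<lambda>i. y (k + i)) else 0) \<partial>S) = \<dots>" .
  qed
  also have "\<dots> = (\<integral>\<^sup>+y. (\<Sum>k. (if first_passage y k then ennreal (q ^ k) else 0) * (\<integral>\<^sup>+z. ladder_transform q r z \<partial>S)) \<partial>S)"
    by (rule nn_integral_suminf[symmetric]) measurable
  also have "\<dots> = (\<integral>\<^sup>+y. passage_transform q y * (\<integral>\<^sup>+z. ladder_transform q r z \<partial>S) \<partial>S)"
    unfolding passage_transform_def by (simp add: ennreal_suminf_multc)
  also have "\<dots> = (\<integral>\<^sup>+y. passage_transform q y \<partial>S) ^ Suc r"
    unfolding Suc.IH by (subst nn_integral_multc) (auto simp: mult.commute)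
  finally show ?case .
qed

text \<open>Since \<open>1 / 0 = 0\<close>, the summands with \<open>n = 0\<close> and \<open>r = 0\<close> vanish. If the
  expectation \<open>a\<close> of the passage transform is less than \<open>1\<close>, the right-hand side is \<open>- ln (1 - a)\<close>; as a
  series it also has the right value \<open>\<infinity>\<close> for \<open>a = 1\<close>.\<close>

lemma sparre_andersen:
  assumes "q \<ge> 0"
  shows "(\<Sum>n. ennreal (q ^ n / real n) * emeasure S {y \<in> space S. psum y n > 0})
       = (\<Sum>r. ennreal (1 / real r) * (\<integral>\<^sup>+y. passage_transform q y \<partial>S) ^ r)"
proof -
  let ?t = "\<lambda>r n y. if ladder y n \<and> ladder_count y n = r then ennreal (q ^ n) else 0"
  have "(\<Sum>n. ennreal (q ^ n / real n) * emeasure S {y \<in> space S. psum y n > 0})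
      = (\<Sum>n. \<integral>\<^sup>+y. ennreal (q ^ n) * ennreal (of_bool (ladder y n) / real (ladder_count y n)) \<partial>S)"
  proof (rule suminf_cong)
    fix n
    show "ennreal (q ^ n / real n) * emeasure S {y \<in> space S. psum y n > 0}
      = (\<integral>\<^sup>+y. ennreal (q ^ n) * ennreal (of_bool (ladder y n) / real (ladder_count y n)) \<partial>S)"
    proof (cases "n = 0")
      case False
      have "ennreal (q ^ n / real n) = ennreal (q ^ n) * ennreal (1 / real n)"
        using assms by (subst ennreal_mult[symmetric]) auto
      thus ?thesis using False
        by (subst nn_integral_cmult) (auto simp: sparre_andersen_expectation mult.assoc)
    qed (simp add: ladder_count_def)
  qed
  also have "\<dots> = (\<integral>\<^sup>+y. (\<Sum>n. ennreal (q ^ n) * ennreal (of_bool (ladder y n) / real (ladder_count y n))) \<partial>S)"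
    by (rule nn_integral_suminf[symmetric]) measurable
  also have "\<dots> = (\<integral>\<^sup>+y. (\<Sum>r. ennreal (1 / real r) * ladder_transform q r y) \<partial>S)"
  proof (intro nn_integral_cong)
    fix y
    have "(\<Sum>n. ennreal (q ^ n) * ennreal (of_bool (ladder y n) / real (ladder_count y n)))
        = (\<Sum>n. \<Sum>r. ennreal (1 / real r) * ?t r n y)"
      by (intro suminf_cong, subst suminf_single_ennreal[of "ladder_count y n" for n])
        (auto simp: mult.commute)
    also have "\<dots> = (\<Sum>r. \<Sum>n. ennreal (1 / real r) * ?t r n y)"
      unfolding nn_integral_count_space_nat[symmetric]
      by (rule pair_sigma_finite.Fubini')
        (auto intro!: pair_sigma_finite.intro sigma_finite_measure_count_space simp: pair_measure_countable)
    also have "\<dots> = (\<Sum>r. ennreal (1 / real r) * ladder_transform q r y)"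
      unfolding ladder_transform_def by (simp add: ennreal_suminf_cmult)
    finally show "(\<Sum>n. ennreal (q ^ n) * ennreal (of_bool (ladder y n) / real (ladder_count y n)))
      = (\<Sum>r. ennreal (1 / real r) * ladder_transform q r y)" .
  qed
  also have "\<dots> = (\<Sum>r. \<integral>\<^sup>+y. ennreal (1 / real r) * ladder_transform q r y \<partial>S)"
    by (rule nn_integral_suminf) measurable
  also have "\<dots> = (\<Sum>r. ennreal (1 / real r) * (\<integral>\<^sup>+y. passage_transform q y \<partial>S) ^ r)"
    using assms by (simp add: nn_integral_cmult nn_integral_ladder_transform)
  finally show ?thesis .
qed

end

section \<open>Averaging over the mesh of the grid\<close>

text \<open>Both series may start at \<open>n = 0\<close>, because \<open>1 / 0 = 0\<close>. The second one is the weight at time \<open>t\<close> that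
  the mean of the first one over all meshes in \<open>(0, \<delta>]\<close> gives to \<open>exp (- t) * p t\<close>.\<close>

definition grid_series :: "(real \<Rightarrow> real) \<Rightarrow> real \<Rightarrow> ennreal" where
  "grid_series p h = (\<Sum>n. ennreal (exp (- (real n * h)) / real n * p (real n * h)))"

definition grid_weight :: "real \<Rightarrow> real \<Rightarrow> ennreal" where
  "grid_weight \<delta> t = (\<Sum>n. ennreal (1 / (\<delta> * (real n)\<^sup>2)) * indicator {..real n * \<delta>} t)"

text \<open>With \<open>m\<close> the least integer such that \<open>t \<le> m * \<delta>\<close>, the weight is \<open>1 / \<delta>\<close> times the tail of
  \<open>\<Sum> 1 / n\<^sup>2\<close> from \<open>m\<close> on. Comparison of \<open>1 / n\<^sup>2\<close> with \<open>1 / (n * (n + 1))\<close>, whose tail telescopes to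
  \<open>1 / m\<close>, gives both bounds.\<close>

lemma grid_weight_bounds:
  assumes "\<delta> > 0" "t > 0"
  shows "ennreal (1 / (t + \<delta>)) \<le> grid_weight \<delta> t" and "grid_weight \<delta> t \<le> ennreal (2 / t)"
proof -
  define m where "m = nat \<lceil>t / \<delta>\<rceil>"
  have "t / \<delta> > 0" using assms by simp
  hence m: "m > 0" "t / \<delta> \<le> real m" "real m \<le> t / \<delta> + 1"
    unfolding m_def by linarith+
  have iff: "t \<le> real n * \<delta> \<longleftrightarrow> m \<le> n" for n
  proof -
    have "t \<le> real n * \<delta> \<longleftrightarrow> t / \<delta> \<le> real n"
      using assms by (simp add: field_simps)
    also have "\<dots> \<longleftrightarrow> m \<le> n"
      unfolding m_def by linarith
    finally show ?thesis .
  qed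
  have W: "grid_weight \<delta> t = (\<Sum>n. ennreal (1 / (\<delta> * (real (n + m))\<^sup>2)))"
    unfolding grid_weight_def
    by (subst suminf_offset[of _ m]) (auto simp: iff indicator_def simp del: of_nat_add)
  let ?d = "\<lambda>n. 1 / real (n + m) - 1 / real (Suc n + m)"
  have lim: "(\<lambda>n. 1 / real (n + m)) \<longlonglongrightarrow> 0"
    using LIMSEQ_ignore_initial_segment[OF lim_1_over_n, of m] by simp
  have d: "?d sums (1 / real m)"
    using telescope_sums'[OF lim] by simp
  have d_eq: "?d n = 1 / (real (n + m) * (real (n + m) + 1))" for n
    using m(1) by (simp add: field_simps)
  have "(\<Sum>n. ennreal (c / \<delta> * ?d n)) = ennreal (c / \<delta> * (1 / real m))" if "c \<ge> 0" for c
    using that assms d_eq by (intro suminf_ennreal_eq sums_mult d) (auto simp del: of_nat_Suc of_nat_add)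
  note sums = this
  have "ennreal (1 / (t + \<delta>)) \<le> ennreal (1 / \<delta> * (1 / real m))"
    using assms m by (intro ennreal_leI) (auto simp: field_simps)
  also have "\<dots> = (\<Sum>n. ennreal (1 / \<delta> * ?d n))"
    by (rule sums[symmetric]) simp
  also have "\<dots> \<le> grid_weight \<delta> t"
    unfolding W
  proof (intro suminf_le ennreal_leI)
    fix n
    have "?d n \<le> 1 / (real (n + m))\<^sup>2"
      unfolding d_eq power2_eq_square using m(1)
      by (intro divide_left_mono mult_left_mono) auto
    hence "1 / \<delta> * ?d n \<le> 1 / \<delta> * (1 / (real (n + m))\<^sup>2)"
      using assms by (intro mult_left_mono) auto
    thus "1 / \<delta> * ?d n \<le> 1 / (\<delta> * (real (n + m))\<^sup>2)"
      by simp
  qed auto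
  finally show "ennreal (1 / (t + \<delta>)) \<le> grid_weight \<delta> t" .
  have "grid_weight \<delta> t \<le> (\<Sum>n. ennreal (2 / \<delta> * ?d n))"
    unfolding W
  proof (intro suminf_le ennreal_leI)
    fix n
    have "1 / (real (n + m))\<^sup>2 = 2 / (real (n + m) * (2 * real (n + m)))"
      by (simp add: power2_eq_square del: of_nat_add)
    also have "\<dots> \<le> 2 / (real (n + m) * (real (n + m) + 1))"
      using m(1) by (intro divide_left_mono mult_left_mono) auto
    also have "\<dots> = 2 * ?d n"
      unfolding d_eq by simp
    finally have "1 / \<delta> * (1 / (real (n + m))\<^sup>2) \<le> 1 / \<delta> * (2 * ?d n)"
      using assms by (intro mult_left_mono) auto
    thus "1 / (\<delta> * (real (n + m))\<^sup>2) \<le> 2 / \<delta> * ?d n"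
      by simp
  qed auto
  also have "\<dots> = ennreal (2 / \<delta> * (1 / real m))"
    by (rule sums) simp
  also have "\<dots> \<le> ennreal (2 / t)"
    using assms m by (intro ennreal_leI) (auto simp: field_simps)
  finally show "grid_weight \<delta> t \<le> ennreal (2 / t)" .
qed

lemma measurable_grid_weight [measurable]: "grid_weight \<delta> \<in> borel_measurable borel"
  unfolding grid_weight_def[abs_def] by measurable

lemma measurable_grid_series [measurable]:
  assumes [measurable]: "p \<in> borel_measurable borel"
  shows "grid_series p \<in> borel_measurable borel"
  unfolding grid_series_def[abs_def] by measurable

text \<open>In the \<open>n\<close>-th term of the series substitute \<open>t = n * \<delta> * u\<close>. The factor \<open>1 / n\<close> of the series and
  the Jacobian \<open>1 / (n * \<delta>)\<close> combine to the coefficient of the weight.\<close>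

lemma average_grid_series:
  assumes [measurable]: "p \<in> borel_measurable borel" and p0: "\<And>t. p t \<ge> 0" and \<delta>: "\<delta> > 0"
  shows "(\<integral>\<^sup>+u\<in>{0<..1}. grid_series p (\<delta> * u) \<partial>lborel)
       = (\<integral>\<^sup>+t\<in>{0<..}. ennreal (exp (- t) * p t) * grid_weight \<delta> t \<partial>lborel)"
proof -
  have "(\<integral>\<^sup>+u\<in>{0<..1}. grid_series p (\<delta> * u) \<partial>lborel)
     = (\<integral>\<^sup>+u. (\<Sum>n. ennreal (exp (- (real n * (\<delta> * u))) / real n * p (real n * (\<delta> * u))) * indicator {0<..1} u) \<partial>lborel)"
    unfolding grid_series_def by simp
  also have "\<dots> = (\<Sum>n. \<integral>\<^sup>+u. ennreal (exp (- (real n * (\<delta> * u))) / real n * p (real n * (\<delta> * u))) * indicator {0<..1} u \<partial>lborel)"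
    by (rule nn_integral_suminf) measurable
  also have "\<dots> = (\<Sum>n. \<integral>\<^sup>+t. ennreal (exp (- t) * p t) * (ennreal (1 / (\<delta> * (real n)\<^sup>2)) * indicator {..real n * \<delta>} t) * indicator {0<..} t \<partial>lborel)"
  proof (rule suminf_cong)
    fix n
    show "(\<integral>\<^sup>+u. ennreal (exp (- (real n * (\<delta> * u))) / real n * p (real n * (\<delta> * u))) * indicator {0<..1} u \<partial>lborel)
      = (\<integral>\<^sup>+t. ennreal (exp (- t) * p t) * (ennreal (1 / (\<delta> * (real n)\<^sup>2)) * indicator {..real n * \<delta>} t) * indicator {0<..} t \<partial>lborel)"
    proof (cases "n = 0")
      case False
      define c where "c = real n * \<delta>"
      have c: "c > 0" using False \<delta> by (simp add: c_def)
      have n: "real n > 0" using False by simp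
      have "(\<integral>\<^sup>+t. ennreal (exp (- t) * p t) * (ennreal (1 / (\<delta> * (real n)\<^sup>2)) * indicator {..c} t) * indicator {0<..} t \<partial>lborel)
        = ennreal c * (\<integral>\<^sup>+u. ennreal (exp (- (c * u)) * p (c * u)) * (ennreal (1 / (\<delta> * (real n)\<^sup>2)) * indicator {..c} (c * u)) * indicator {0<..} (c * u) \<partial>lborel)"
        by (subst nn_integral_real_affine[of _ c 0]) (use c in auto)
      also have "\<dots> = (\<integral>\<^sup>+u. ennreal c * (ennreal (exp (- (c * u)) * p (c * u)) * (ennreal (1 / (\<delta> * (real n)\<^sup>2)) * indicator {..c} (c * u)) * indicator {0<..} (c * u)) \<partial>lborel)"
        by (rule nn_integral_cmult[symmetric]) measurable
      also have "\<dots> = (\<integral>\<^sup>+u. ennreal (exp (- (real n * (\<delta> * u))) / real n * p (real n * (\<delta> * u))) * indicator {0<..1} u \<partial>lborel)"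
      proof (rule nn_integral_cong)
        fix u
        have "ennreal c * (ennreal (exp (- (c * u)) * p (c * u)) * ennreal (1 / (\<delta> * (real n)\<^sup>2)))
          = ennreal (c * (exp (- (c * u)) * p (c * u) * (1 / (\<delta> * (real n)\<^sup>2))))"
          using c \<delta> p0[of "c * u"] by (simp add: ennreal_mult[symmetric] del: times_divide_eq_right)
        also have "c * (exp (- (c * u)) * p (c * u) * (1 / (\<delta> * (real n)\<^sup>2))) = exp (- (c * u)) / real n * p (c * u)"
          using n \<delta> by (simp add: c_def power2_eq_square field_simps)
        finally show "ennreal c * (ennreal (exp (- (c * u)) * p (c * u)) * (ennreal (1 / (\<delta> * (real n)\<^sup>2)) * indicator {..c} (c * u)) * indicator {0<..} (c * u))
          = ennreal (exp (- (real n * (\<delta> * u))) / real n * p (real n * (\<delta> * u))) * indicator {0<..1} u"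
          using c by (auto simp: indicator_def c_def mult.assoc zero_less_mult_iff)
      qed
      finally show ?thesis by (simp add: c_def)
    qed simp
  qed
  also have "\<dots> = (\<integral>\<^sup>+t. (\<Sum>n. ennreal (exp (- t) * p t) * (ennreal (1 / (\<delta> * (real n)\<^sup>2)) * indicator {..real n * \<delta>} t) * indicator {0<..} t) \<partial>lborel)"
    by (rule nn_integral_suminf[symmetric]) measurable
  also have "\<dots> = (\<integral>\<^sup>+t\<in>{0<..}. ennreal (exp (- t) * p t) * grid_weight \<delta> t \<partial>lborel)"
    unfolding grid_weight_def by simp
  finally show ?thesis .
qed

text \<open>The exponential factor only matters for large \<open>t\<close>, where the second integral has no mass and the
  first one is at most \<open>\<integral> exp (- t) dt\<close>.\<close>

lemma exp_weight_infinite_iff: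
  assumes [measurable]: "p \<in> borel_measurable borel" and p: "\<And>t. 0 \<le> p t" "\<And>t. p t \<le> 1"
  shows "(\<integral>\<^sup>+t\<in>{0<..}. ennreal (exp (- t) * p t / t) \<partial>lborel) = \<infinity> \<longleftrightarrow>
         (\<integral>\<^sup>+t\<in>{0<..1}. ennreal (1 / t * p t) \<partial>lborel) = \<infinity>"
    (is "?K = \<infinity> \<longleftrightarrow> ?J = \<infinity>")
proof -
  have "?J \<le> (\<integral>\<^sup>+t. ennreal (exp 1) * (ennreal (exp (- t) * p t / t) * indicator {0<..} t) \<partial>lborel)"
  proof (rule nn_integral_mono)
    fix t :: real
    have "1 / t * p t \<le> exp 1 * (exp (- t) * p t / t)" if "0 < t" "t \<le> 1"
    proof -
      have "1 * (p t / t) \<le> exp (1 - t) * (p t / t)"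
        using that p by (intro mult_right_mono) auto
      thus ?thesis by (simp add: exp_diff exp_minus field_simps)
    qed
    thus "ennreal (1 / t * p t) * indicator {0<..1} t \<le> ennreal (exp 1) * (ennreal (exp (- t) * p t / t) * indicator {0<..} t)"
      using p by (auto simp: indicator_def ennreal_mult'[symmetric] intro!: ennreal_leI)
  qed
  also have "\<dots> = ennreal (exp 1) * ?K"
    by (rule nn_integral_cmult) measurable
  finally have 1: "?J \<le> ennreal (exp 1) * ?K" .
  have "?K \<le> (\<integral>\<^sup>+t. ennreal (1 / t * p t) * indicator {0<..1} t + ennreal (t ^ 0 * exp (- t)) * indicator {0..} t \<partial>lborel)"
  proof (rule nn_integral_mono)
    fix t :: real
    have "exp (- t) * p t / t \<le> 1 / t * p t" if "0 < t"
      using that p[of t] mult_right_mono[of "exp (- t)" 1 "p t"] by (simp add: divide_right_mono)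
    moreover have "exp (- t) * p t / t \<le> exp (- t)" if "1 < t"
    proof -
      have "exp (- t) * p t \<le> exp (- t) * t"
        using that p[of t] by (intro mult_left_mono) auto
      thus ?thesis using that by (simp add: field_simps)
    qed
    ultimately show "ennreal (exp (- t) * p t / t) * indicator {0<..} t \<le>
        ennreal (1 / t * p t) * indicator {0<..1} t + ennreal (t ^ 0 * exp (- t)) * indicator {0..} t"
      by (auto simp: indicator_def intro!: ennreal_leI add_increasing2)
  qed
  also have "\<dots> = ?J + (\<integral>\<^sup>+t. ennreal (t ^ 0 * exp (- t)) * indicator {0..} t \<partial>lborel)"
    by (rule nn_integral_add) measurable
  also have "\<dots> = ?J + 1"
    by (subst nn_intergal_power_times_exp_Ici) simp
  finally have 2: "?K \<le> ?J + 1" .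
  show ?thesis
  proof
    assume "?K = \<infinity>"
    with 2 show "?J = \<infinity>" by (auto simp: top_unique)
  next
    assume "?J = \<infinity>"
    with 1 show "?K = \<infinity>" by (auto simp: top_unique ennreal_mult_eq_top_iff)
  qed
qed

text \<open>The means of the series inherit the bound, and they dominate the integrals with \<open>1 / (t + \<delta>)\<close> in place
  of \<open>1 / t\<close>; let \<open>\<delta> \<rightarrow> 0\<close>.\<close>

lemma exp_weight_le_grid_series_bound:
  assumes [measurable]: "p \<in> borel_measurable borel" and p: "\<And>t. 0 \<le> p t"
    and C: "\<And>h. h > 0 \<Longrightarrow> grid_series p h \<le> C"
  shows "(\<integral>\<^sup>+t\<in>{0<..}. ennreal (exp (- t) * p t / t) \<partial>lborel) \<le> C"
proof -
  let ?f = "\<lambda>n t. ennreal (exp (- t) * p t / (t + 1 / real (Suc n))) * indicator {0<..} t"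
  have le: "(\<integral>\<^sup>+t. ?f n t \<partial>lborel) \<le> C" for n
  proof -
    define \<delta> where "\<delta> = 1 / real (Suc n)"
    have \<delta>: "\<delta> > 0" by (simp add: \<delta>_def)
    have "(\<integral>\<^sup>+t. ?f n t \<partial>lborel) \<le> (\<integral>\<^sup>+t\<in>{0<..}. ennreal (exp (- t) * p t) * grid_weight \<delta> t \<partial>lborel)"
    proof (rule nn_integral_mono)
      fix t :: real
      have "ennreal (exp (- t) * p t / (t + \<delta>)) \<le> ennreal (exp (- t) * p t) * grid_weight \<delta> t" if "t > 0"
      proof -
        have "ennreal (exp (- t) * p t / (t + \<delta>)) = ennreal (exp (- t) * p t) * ennreal (1 / (t + \<delta>))"
          using that \<delta> p[of t] by (subst ennreal_mult[symmetric]) auto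
        thus ?thesis using grid_weight_bounds(1)[OF \<delta> that] by (auto intro: mult_left_mono)
      qed
      thus "?f n t \<le> ennreal (exp (- t) * p t) * grid_weight \<delta> t * indicator {0<..} t"
        unfolding \<delta>_def[symmetric] by (auto simp: indicator_def)
    qed
    also have "\<dots> = (\<integral>\<^sup>+u\<in>{0<..1}. grid_series p (\<delta> * u) \<partial>lborel)"
      using p \<delta> by (simp add: average_grid_series)
    also have "\<dots> \<le> (\<integral>\<^sup>+u. C * indicator {0<..1} (u::real) \<partial>lborel)"
      using \<delta> by (intro nn_integral_mono) (auto simp: indicator_def intro!: C)
    also have "\<dots> = C"
      by (subst nn_integral_cmult_indicator) auto
    finally show ?thesis .
  qed
  have lim: "(\<lambda>n. ?f n t) \<longlonglongrightarrow> ennreal (exp (- t) * p t / t) * indicator {0<..} t" for t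
  proof (cases "t > 0")
    case True
    have "(\<lambda>n. exp (- t) * p t / (t + 1 / real (Suc n))) \<longlonglongrightarrow> exp (- t) * p t / (t + 0)"
      using True by (intro tendsto_intros LIMSEQ_Suc[OF lim_1_over_n]) auto
    thus ?thesis using True by (auto intro!: tendsto_ennrealI)
  qed auto
  have "(\<integral>\<^sup>+t\<in>{0<..}. ennreal (exp (- t) * p t / t) \<partial>lborel) = (\<integral>\<^sup>+t. liminf (\<lambda>n. ?f n t) \<partial>lborel)"
    by (intro nn_integral_cong lim_imp_Liminf[OF _ lim, symmetric]) simp
  also have "\<dots> \<le> liminf (\<lambda>n. \<integral>\<^sup>+t. ?f n t \<partial>lborel)"
    by (rule nn_integral_liminf) measurable
  also have "\<dots> \<le> liminf (\<lambda>n::nat. C)"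
    by (intro Liminf_mono always_eventually allI le)
  also have "\<dots> = C"
    by (simp add: Liminf_const)
  finally show ?thesis .
qed

text \<open>By Fatou's lemma the means of the series over \<open>(0, \<delta>]\<close> tend to \<open>\<infinity>\<close> as well, while each of them
  is at most twice the integral. Divergence along the sequences \<open>u / (n + 1)\<close> for fixed \<open>u\<close> is all
  that Fatou's lemma asks for.\<close>

lemma exp_weight_infinite_if_grid_series_diverges:
  assumes [measurable]: "p \<in> borel_measurable borel" and p: "\<And>t. 0 \<le> p t"
    and A: "\<And>u. 0 < u \<Longrightarrow> u \<le> 1 \<Longrightarrow> (\<lambda>n. grid_series p (1 / real (Suc n) * u)) \<longlonglongrightarrow> \<infinity>"
  shows "(\<integral>\<^sup>+t\<in>{0<..}. ennreal (exp (- t) * p t / t) \<partial>lborel) = \<infinity>"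
    (is "?K = _")
proof -
  have le: "(\<integral>\<^sup>+u\<in>{0<..1}. grid_series p (\<delta> * u) \<partial>lborel) \<le> 2 * ?K" if \<delta>: "\<delta> > 0" for \<delta>
  proof -
    have "(\<integral>\<^sup>+u\<in>{0<..1}. grid_series p (\<delta> * u) \<partial>lborel)
        = (\<integral>\<^sup>+t\<in>{0<..}. ennreal (exp (- t) * p t) * grid_weight \<delta> t \<partial>lborel)"
      using p \<delta> by (simp add: average_grid_series)
    also have "\<dots> \<le> (\<integral>\<^sup>+t. 2 * (ennreal (exp (- t) * p t / t) * indicator {0<..} t) \<partial>lborel)"
    proof (rule nn_integral_mono)
      fix t :: real
      have "ennreal (exp (- t) * p t) * grid_weight \<delta> t \<le> 2 * ennreal (exp (- t) * p t / t)" if "t > 0"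
      proof -
        have "2 * ennreal (exp (- t) * p t / t) = ennreal (2 * (exp (- t) * p t / t))"
          using that p[of t] by (subst ennreal_mult) auto
        also have "\<dots> = ennreal (exp (- t) * p t * (2 / t))"
          by (simp add: mult_ac)
        also have "\<dots> = ennreal (exp (- t) * p t) * ennreal (2 / t)"
          using that p[of t] by (subst ennreal_mult) auto
        finally show ?thesis using grid_weight_bounds(2)[OF \<delta> that] by (auto intro: mult_left_mono)
      qed
      thus "ennreal (exp (- t) * p t) * grid_weight \<delta> t * indicator {0<..} t
          \<le> 2 * (ennreal (exp (- t) * p t / t) * indicator {0<..} t)"
        by (auto simp: indicator_def)
    qed
    also have "\<dots> = 2 * ?K"
      by (rule nn_integral_cmult) measurable
    finally show ?thesis .
  qed
  have "\<infinity> = (\<integral>\<^sup>+u. \<infinity> * indicator {0<..1::real} u \<partial>lborel)"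
    by (subst nn_integral_cmult_indicator) auto
  also have "\<dots> = (\<integral>\<^sup>+u. liminf (\<lambda>n. grid_series p (1 / real (Suc n) * u) * indicator {0<..1} u) \<partial>lborel)"
  proof (rule nn_integral_cong)
    fix u :: real
    show "\<infinity> * indicator {0<..1} u = liminf (\<lambda>n. grid_series p (1 / real (Suc n) * u) * indicator {0<..1} u)"
    proof (cases "u \<in> {0<..1}")
      case True
      thus ?thesis using lim_imp_Liminf[OF _ A[of u]] by simp
    qed (simp add: Liminf_const)
  qed
  also have "\<dots> \<le> liminf (\<lambda>n. \<integral>\<^sup>+u. grid_series p (1 / real (Suc n) * u) * indicator {0<..1} u \<partial>lborel)"
    by (rule nn_integral_liminf) measurable
  also have "\<dots> \<le> liminf (\<lambda>n::nat. 2 * ?K)"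
    by (intro Liminf_mono always_eventually allI le) simp
  also have "\<dots> = 2 * ?K"
    by (simp add: Liminf_const)
  finally show ?thesis
    by (auto simp: top_unique ennreal_mult_eq_top_iff)
qed

section \<open>The process on a grid\<close>

context levy_process
begin

definition increments :: "real \<Rightarrow> 'a \<Rightarrow> nat \<Rightarrow> real" where
  "increments h \<omega> i = X (real (Suc i) * h) \<omega> - X (real i * h) \<omega>"

lemma psum_increments: "\<omega> \<in> space M \<Longrightarrow> psum (increments h \<omega>) n = X (real n * h) \<omega>"
  unfolding psum_def increments_def by (subst sum_lessThan_telescope) (simp add: start_zero)

lemma measurable_increments: "h > 0 \<Longrightarrow> increments h \<in> measurable M (\<Pi>\<^sub>M i\<in>UNIV. borel)"
  by (rule measurable_PiM_single') (auto simp: increments_def[abs_def] intro!: rv borel_measurable_diff)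

text \<open>Independence of an infinite family is independence of its finite subfamilies, and each of these is part of
  the increments along a finite partition.\<close>

lemma distr_increments:
  assumes h: "h > 0"
  shows "distr M (\<Pi>\<^sub>M i\<in>UNIV. borel) (increments h) = (\<Pi>\<^sub>M i\<in>(UNIV::nat set). distr M borel (X h))"
proof -
  have meas: "random_variable borel (\<lambda>\<omega>. increments h \<omega> i)" for i
    using h by (auto simp: increments_def[abs_def] intro!: rv borel_measurable_diff)
  have "indep_vars (\<lambda>_. borel) (\<lambda>i \<omega>. increments h \<omega> i) {..<n}" for n
    unfolding increments_def using h
    by (intro independent_increments[of "\<lambda>i. real i * h"]) (auto intro!: mult_right_mono)
  hence fin: "indep_vars (\<lambda>_. borel) (\<lambda>i \<omega>. increments h \<omega> i) J" if "finite J" for J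
  proof -
    from that obtain n where "J \<subseteq> {..<n}" using finite_nat_iff_bounded by auto
    thus ?thesis using \<open>\<And>n. indep_vars (\<lambda>_. borel) (\<lambda>i \<omega>. increments h \<omega> i) {..<n}\<close>
      by (rule indep_vars_subset[rotated])
  qed
  have "indep_vars (\<lambda>_. borel) (\<lambda>i \<omega>. increments h \<omega> i) UNIV"
    unfolding indep_vars_def
    using fin meas by (subst indep_sets_finite_index_sets) (auto simp: indep_vars_def)
  hence "distr M (\<Pi>\<^sub>M i\<in>UNIV. borel) (\<lambda>\<omega>. \<lambda>i\<in>UNIV. increments h \<omega> i)
       = (\<Pi>\<^sub>M i\<in>UNIV. distr M borel (\<lambda>\<omega>. increments h \<omega> i))"
    using meas by (subst (asm) indep_vars_iff_distr_eq_PiM') auto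
  moreover have "distr M borel (\<lambda>\<omega>. increments h \<omega> i) = distr M borel (X h)" for i
  proof -
    have "distr M borel (\<lambda>\<omega>. increments h \<omega> i) = distr M borel (\<lambda>\<omega>. X (real i * h + h) \<omega> - X (real i * h) \<omega>)"
      unfolding increments_def by (simp add: algebra_simps)
    also have "\<dots> = distr M borel (\<lambda>\<omega>. X h \<omega> - X 0 \<omega>)"
      using h by (intro stationary_increments) auto
    also have "\<dots> = distr M borel (X h)"
      by (intro distr_cong) (auto simp: start_zero)
    finally show ?thesis .
  qed
  ultimately show ?thesis by (simp add: restrict_UNIV)
qed

text \<open>Freezing the process at negative times makes this a measurable function on the whole line.\<close>

definition positivity :: "real \<Rightarrow> real" where
  "positivity t = prob {\<omega> \<in> space M. X (max 0 t) \<omega> > 0}"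

lemma positivity_bounds: "0 \<le> positivity t" "positivity t \<le> 1"
  by (auto simp: positivity_def)

lemma random_walk_increments:
  assumes "h > 0"
  shows "random_walk (distr M borel (X h))"
proof -
  interpret D: prob_space "distr M borel (X h)"
    using assms by (intro prob_space_distr rv) auto
  show ?thesis by unfold_locales simp
qed

text \<open>Sparre Andersen's identity, transferred from the product space to the process.\<close>

lemma grid_series_positivity:
  assumes h: "h > 0"
  shows "grid_series positivity h =
    (\<Sum>r. ennreal (1 / real r) * (\<integral>\<^sup>+\<omega>. passage_transform (exp (- h)) (increments h \<omega>) \<partial>M) ^ r)"
proof -
  interpret W: random_walk "distr M borel (X h)"
    by (rule random_walk_increments[OF h])
  have S: "W.S = distr M (\<Pi>\<^sub>M i\<in>UNIV. borel) (increments h)"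
    by (rule distr_increments[OF h, symmetric])
  note meas = measurable_increments[OF h]
  have P: "emeasure W.S {y \<in> space W.S. psum y n > 0} = ennreal (positivity (real n * h))" for n
  proof -
    have "{y \<in> space (\<Pi>\<^sub>M i\<in>(UNIV::nat set). (borel :: real measure)). psum y n > 0} \<in> sets (\<Pi>\<^sub>M i\<in>UNIV. borel)"
      by measurable
    hence sets: "{y \<in> space W.S. psum y n > 0} \<in> sets (\<Pi>\<^sub>M i\<in>UNIV. borel)"
      by (simp add: space_PiM)
    have "emeasure W.S {y \<in> space W.S. psum y n > 0}
        = emeasure M (increments h -` {y \<in> space W.S. psum y n > 0} \<inter> space M)"
      using sets unfolding S by (rule emeasure_distr[OF meas])
    also have "increments h -` {y \<in> space W.S. psum y n > 0} \<inter> space M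
        = {\<omega> \<in> space M. X (max 0 (real n * h)) \<omega> > 0}"
      using h by (auto simp: psum_increments space_PiM)
    finally show ?thesis by (simp add: positivity_def emeasure_eq_measure)
  qed
  have "(\<integral>\<^sup>+y. passage_transform (exp (- h)) y \<partial>W.S) = (\<integral>\<^sup>+\<omega>. passage_transform (exp (- h)) (increments h \<omega>) \<partial>M)"
    unfolding S by (rule nn_integral_distr[OF meas]) simp
  moreover have "grid_series positivity h
     = (\<Sum>n. ennreal (exp (- h) ^ n / real n) * emeasure W.S {y \<in> space W.S. psum y n > 0})"
    unfolding grid_series_def P
  proof (rule suminf_cong)
    fix n
    have "exp (- (real n * h)) = exp (- h) ^ n"
      by (simp add: exp_of_nat_mult[symmetric])
    thus "ennreal (exp (- (real n * h)) / real n * positivity (real n * h))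
        = ennreal (exp (- h) ^ n / real n) * ennreal (positivity (real n * h))"
      by (simp only: ennreal_mult''[OF positivity_bounds(1)])
  qed
  ultimately show ?thesis
    using W.sparre_andersen[of "exp (- h)"] by simp
qed

section \<open>Consequences of right continuity\<close>

lemma right_continuous: "\<omega> \<in> space M \<Longrightarrow> t \<ge> 0 \<Longrightarrow> ((\<lambda>s. X s \<omega>) \<longlongrightarrow> X t \<omega>) (at_right t)"
  using cadlag_paths[of \<omega>] by (auto simp: cadlag_def)

lemma positive_on_right_neighbourhood:
  assumes "\<omega> \<in> space M" "t \<ge> 0" "X t \<omega> > 0"
  obtains e where "e > 0" "\<And>s. s \<in> {t..<t + e} \<Longrightarrow> X s \<omega> > 0"
proof -
  have "eventually (\<lambda>s. X s \<omega> > 0) (at_right t)"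
    using right_continuous[OF assms(1,2)] assms(3) by (rule order_tendstoD)
  then obtain b where "b > t" "\<And>s. s \<in> {t<..<b} \<Longrightarrow> X s \<omega> > 0"
    unfolding eventually_at_right_field by auto
  thus ?thesis using assms(3) by (intro that[of "b - t"]) (auto simp: le_less)
qed

text \<open>By right continuity the process is the pointwise limit of its values at the next grid point of mesh
  \<open>1 / (n + 1)\<close> strictly after \<open>t\<close>, and these are jointly measurable, being taken from countably many times.\<close>

lemma measurable_process: "(\<lambda>(t, \<omega>). X (max 0 t) \<omega>) \<in> borel_measurable (borel \<Otimes>\<^sub>M M)"
proof (rule borel_measurable_LIMSEQ_metric)
  let ?k = "\<lambda>n t. Suc (nat \<lfloor>real (Suc n) * max 0 t\<rfloor>)"
  show "(\<lambda>(t, \<omega>). X (real (?k n t) / real (Suc n)) \<omega>) \<in> borel_measurable (borel \<Otimes>\<^sub>M M)" for n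
  proof -
    have "(\<lambda>p. X (real (?k n (fst p)) / real (Suc n)) (snd p)) \<in> borel_measurable (borel \<Otimes>\<^sub>M M)"
    proof (rule measurable_compose_countable[where f = "\<lambda>k p. X (real k / real (Suc n)) (snd p)"])
      fix k :: nat
      have [measurable]: "X (real k / real (Suc n)) \<in> borel_measurable M" by (rule rv) simp
      show "(\<lambda>p. X (real k / real (Suc n)) (snd p)) \<in> borel_measurable (borel \<Otimes>\<^sub>M M)" by measurable
    qed measurable
    thus ?thesis by (simp add: split_beta')
  qed
  fix p :: "real \<times> 'a" assume "p \<in> space (borel \<Otimes>\<^sub>M M)"
  then obtain t \<omega> where p: "p = (t, \<omega>)" "\<omega> \<in> space M" by (auto simp: space_pair_measure)
  define s where "s n = real (?k n t) / real (Suc n)" for n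
  have gt: "s n > max 0 t" and le: "s n \<le> max 0 t + 1 / real (Suc n)" for n
  proof -
    have "real (Suc (nat \<lfloor>x\<rfloor>)) > x" "real (Suc (nat \<lfloor>x\<rfloor>)) \<le> x + 1" if "x \<ge> 0" for x
      using that by linarith+
    from this[of "real (Suc n) * max 0 t"]
    have "real (?k n t) > real (Suc n) * max 0 t" "real (?k n t) \<le> real (Suc n) * max 0 t + 1"
      by simp_all
    thus "s n > max 0 t" "s n \<le> max 0 t + 1 / real (Suc n)"
      unfolding s_def by (simp_all only: less_divide_eq divide_le_eq distrib_right of_nat_0_less_iff zero_less_Suc
        if_True nonzero_divide_eq_eq) (simp_all add: mult.commute)
  qed
  have "(\<lambda>n. max 0 t + 1 / real (Suc n)) \<longlonglongrightarrow> max 0 t + 0"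
    by (intro tendsto_intros LIMSEQ_Suc[OF lim_1_over_n])
  hence "s \<longlonglongrightarrow> max 0 t"
    using gt le by (intro tendsto_sandwich[of "\<lambda>_. max 0 t" s sequentially]) (auto intro: always_eventually less_imp_le)
  moreover have "s n \<noteq> max 0 t" for n
    using gt[of n] by (rule less_imp_neq[THEN not_sym])
  hence "eventually (\<lambda>n. s n \<in> {max 0 t<..} \<and> s n \<noteq> max 0 t) sequentially"
    using gt unfolding greaterThan_iff by (intro always_eventually allI conjI)
  ultimately have "filterlim s (at_right (max 0 t)) sequentially"
    unfolding filterlim_at by (intro conjI)
  moreover have "((\<lambda>s. X s \<omega>) \<longlongrightarrow> X (max 0 t) \<omega>) (at_right (max 0 t))"
    using p(2) by (rule right_continuous) simp
  ultimately have "(\<lambda>n. X (s n) \<omega>) \<longlonglongrightarrow> X (max 0 t) \<omega>"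
    by (rule filterlim_compose[rotated])
  thus "(\<lambda>n. case p of (t, \<omega>) \<Rightarrow> X (real (?k n t) / real (Suc n)) \<omega>) \<longlonglongrightarrow> (case p of (t, \<omega>) \<Rightarrow> X (max 0 t) \<omega>)"
    by (simp add: p s_def)
qed

lemma measurable_positivity: "positivity \<in> borel_measurable borel"
proof -
  note measurable_process[measurable]
  have "(\<lambda>t. emeasure M (Pair t -` {p \<in> space (borel \<Otimes>\<^sub>M M). (case p of (t, \<omega>) \<Rightarrow> X (max 0 t) \<omega>) > 0})) \<in> borel_measurable borel"
    by (rule measurable_emeasure_Pair) measurable
  moreover have "Pair t -` {p \<in> space (borel \<Otimes>\<^sub>M M). (case p of (t, \<omega>) \<Rightarrow> X (max 0 t) \<omega>) > 0}
     = {\<omega> \<in> space M. X (max 0 t) \<omega> > 0}" for t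
    by (auto simp: space_pair_measure)
  ultimately have "(\<lambda>t. enn2real (emeasure M {\<omega> \<in> space M. X (max 0 t) \<omega> > 0})) \<in> borel_measurable borel"
    by simp
  thus ?thesis by (simp add: positivity_def[abs_def] measure_def)
qed

definition positive_by :: "real \<Rightarrow> 'a set" where
  "positive_by t = (\<Union>s\<in>{0..t}. {\<omega> \<in> space M. X s \<omega> > 0})"

lemma positive_by_mono: "s \<le> t \<Longrightarrow> positive_by s \<subseteq> positive_by t"
  unfolding positive_by_def by fastforce

text \<open>A path that is positive at a time \<open>s < t\<close> is positive at some rational time shortly after \<open>s\<close>. Only
  the endpoint \<open>t\<close>, to which this does not apply, has to be kept.\<close>

lemma sets_positive_by:
  assumes t: "t \<ge> 0"
  shows "positive_by t \<in> sets M"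
proof -
  have "positive_by t = {\<omega> \<in> space M. X t \<omega> > 0} \<union> (\<Union>s\<in>\<rat> \<inter> {0..t}. {\<omega> \<in> space M. X s \<omega> > 0})"
    (is "_ = ?R")
  proof (intro equalityI subsetI)
    fix \<omega> assume "\<omega> \<in> positive_by t"
    then obtain s where s: "s \<in> {0..t}" "\<omega> \<in> space M" "X s \<omega> > 0" by (auto simp: positive_by_def)
    show "\<omega> \<in> ?R"
    proof (cases "s = t")
      case False
      obtain e where e: "e > 0" "\<And>r. r \<in> {s..<s + e} \<Longrightarrow> X r \<omega> > 0"
        using positive_on_right_neighbourhood[of \<omega> s] s by auto
      obtain r where "r \<in> \<rat>" "s < r" "r < min t (s + e)"
        using Rats_dense_in_real[of s "min t (s + e)"] e(1) s False by auto
      thus ?thesis using s e(2)[of r] by auto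
    qed (use s in auto)
  qed (use t in \<open>auto simp: positive_by_def\<close>)
  moreover have "{\<omega> \<in> space M. X s \<omega> > 0} \<in> sets M" if "s \<ge> 0" for s
    using rv[OF that] by measurable
  ultimately show ?thesis
    using t by (auto intro!: sets.countable_UN' countable_Int1 countable_rat)
qed

lemma regular_iff: "regular_for_positive_half_line M X \<longleftrightarrow> prob (\<Inter>n. positive_by (1 / real (Suc n))) = 1"
proof -
  have "(\<Inter>t\<in>{0<..}. positive_by t) = (\<Inter>n. positive_by (1 / real (Suc n)))"
  proof (intro equalityI subsetI INT_I)
    fix \<omega> t assume *: "\<omega> \<in> (\<Inter>n. positive_by (1 / real (Suc n)))" and "(t::real) \<in> {0<..}"
    then obtain n where "1 / real (Suc n) < t" using nat_approx_posE[of t] by auto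
    thus "\<omega> \<in> positive_by t" using * positive_by_mono[of "1 / real (Suc n)" t] by auto
  qed auto
  thus ?thesis unfolding regular_for_positive_half_line_def positive_by_def by simp
qed

text \<open>If the path is positive at some \<open>s\<close> close to \<open>0\<close>, it is positive on an interval to the right of
  \<open>s\<close>, which contains a grid point as soon as the mesh is smaller than the interval. So the first passage on
  the grid happens at most one mesh later than \<open>s\<close>.\<close>

lemma passage_transform_tendsto_1:
  assumes \<omega>: "\<omega> \<in> (\<Inter>n. positive_by (1 / real (Suc n)))"
    and h: "\<And>n. h n > 0" "h \<longlonglongrightarrow> 0"
  shows "(\<lambda>n. passage_transform (exp (- h n)) (increments (h n) \<omega>)) \<longlonglongrightarrow> 1"
proof -
  have le1: "passage_transform (exp (- h n)) (increments (h n) \<omega>) \<le> 1" for n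
    using passage_transform_le[of "exp (- h n)" "increments (h n) \<omega>" 0] h(1)[of n] by simp
  have \<omega>M: "\<omega> \<in> space M" using \<omega> by (auto simp: positive_by_def)
  have ev: "eventually (\<lambda>n. ennreal (exp (- (2 * e))) \<le> passage_transform (exp (- h n)) (increments (h n) \<omega>)) sequentially"
    if e: "e > 0" for e
  proof -
    obtain m where m: "1 / real (Suc m) < e" using nat_approx_posE[OF e] by auto
    from \<omega> have "\<omega> \<in> positive_by (1 / real (Suc m))" by blast
    then obtain s where s: "0 \<le> s" "s \<le> 1 / real (Suc m)" "X s \<omega> > 0" by (auto simp: positive_by_def)
    obtain d where d: "d > 0" "\<And>r. r \<in> {s..<s + d} \<Longrightarrow> X r \<omega> > 0"
      using positive_on_right_neighbourhood[OF \<omega>M s(1,3)] by auto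
    have "eventually (\<lambda>n. h n < min d e) sequentially"
      using h(2) d(1) e by (intro order_tendstoD) auto
    thus ?thesis
    proof eventually_elim
      case (elim n)
      define k where "k = nat \<lceil>s / h n\<rceil>"
      have "s / h n \<ge> 0" using s h(1)[of n] by simp
      hence "s / h n \<le> real k" "real k < s / h n + 1"
        unfolding k_def by linarith+
      hence k: "s \<le> real k * h n" "real k * h n < s + h n"
        using h(1)[of n] by (simp_all add: field_simps)
      hence "X (real k * h n) \<omega> > 0"
        using elim by (intro d) auto
      hence "psum (increments (h n) \<omega>) k > 0"
        by (simp add: psum_increments[OF \<omega>M])
      then obtain l where l: "l \<le> k" "first_passage (increments (h n) \<omega>) l"
        using first_passage_exists by blast
      have "real l * h n \<le> real k * h n"
        using l(1) h(1)[of n] by (intro mult_right_mono) auto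
      also have "\<dots> \<le> 2 * e"
        using k s m elim by auto
      finally have "exp (- (2 * e)) \<le> exp (- h n) ^ l"
        by (simp add: exp_of_nat_mult[symmetric])
      thus ?case
        unfolding passage_transform_eq[OF l(2)] by (rule ennreal_leI)
    qed
  qed
  show ?thesis
  proof (rule order_tendstoI)
    fix a :: ennreal assume "a < 1"
    have "((\<lambda>e. ennreal (exp (- (2 * e)))) \<longlongrightarrow> ennreal (exp (- (2 * 0)))) (at_right 0)"
      by (intro tendsto_intros)
    hence "eventually (\<lambda>e. a < ennreal (exp (- (2 * e)))) (at_right 0)"
      using \<open>a < 1\<close> by (intro order_tendstoD) auto
    hence "eventually (\<lambda>e. a < ennreal (exp (- (2 * e))) \<and> e > 0) (at_right (0::real))"
      by (intro eventually_conj) (auto simp: eventually_at_right_less)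
    then obtain e where e: "a < ennreal (exp (- (2 * e)))" "e > 0"
      using eventually_happens trivial_limit_at_right_real by blast
    show "eventually (\<lambda>n. a < passage_transform (exp (- h n)) (increments (h n) \<omega>)) sequentially"
      using ev[OF e(2)] by eventually_elim (rule less_le_trans[OF e(1)])
  next
    fix a :: ennreal assume "1 < a"
    thus "eventually (\<lambda>n. passage_transform (exp (- h n)) (increments (h n) \<omega>) < a) sequentially"
      using le1 by (intro always_eventually allI) (rule le_less_trans)
  qed
qed

section \<open>Rogozin's criterion\<close>

text \<open>The transforms of the first passage times tend to \<open>1\<close>, so the series on the right of Sparre Andersen's
  identity eventually exceeds every partial sum of the harmonic series.\<close>

lemma grid_series_tendsto_infinity:
  assumes reg: "regular_for_positive_half_line M X" and h: "\<And>n. h n > 0" "h \<longlonglongrightarrow> 0"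
  shows "(\<lambda>n. grid_series positivity (h n)) \<longlonglongrightarrow> \<infinity>"
proof -
  define a where "a n = (\<integral>\<^sup>+\<omega>. passage_transform (exp (- h n)) (increments (h n) \<omega>) \<partial>M)" for n
  have meas: "(\<lambda>\<omega>. passage_transform (exp (- h n)) (increments (h n) \<omega>)) \<in> borel_measurable M" for n
    by (rule measurable_compose[OF measurable_increments[OF h(1)] measurable_passage_transform])
  have "(\<Inter>n. positive_by (1 / real (Suc n))) \<in> sets M"
    by (intro sets.countable_INT) (auto intro!: sets_positive_by)
  hence "AE \<omega> in M. \<omega> \<in> (\<Inter>n. positive_by (1 / real (Suc n)))"
    using reg AE_in_set_eq_1 unfolding regular_iff by blast
  hence lim: "AE \<omega> in M. (\<lambda>n. passage_transform (exp (- h n)) (increments (h n) \<omega>)) \<longlonglongrightarrow> 1"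
    by eventually_elim (rule passage_transform_tendsto_1[OF _ h])
  have "1 = (\<integral>\<^sup>+\<omega>. 1 \<partial>M)" by (simp add: emeasure_space_1)
  also have "\<dots> = (\<integral>\<^sup>+\<omega>. liminf (\<lambda>n. passage_transform (exp (- h n)) (increments (h n) \<omega>)) \<partial>M)"
    using lim by (intro nn_integral_cong_AE, eventually_elim) (simp add: lim_imp_Liminf)
  also have "\<dots> \<le> liminf a"
    unfolding a_def by (rule nn_integral_liminf[OF meas])
  finally have "1 \<le> liminf a" .
  have a_le: "a n \<le> 1" for n
  proof -
    have "a n \<le> (\<integral>\<^sup>+\<omega>. 1 \<partial>M)"
      unfolding a_def
      using passage_transform_le[of "exp (- h n)" _ 0] h(1)[of n] by (intro nn_integral_mono) simp
    thus ?thesis by (simp add: emeasure_space_1)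
  qed
  have "a \<longlonglongrightarrow> 1"
  proof (rule order_tendstoI)
    fix b :: ennreal assume "b < 1"
    hence "b < liminf a" using \<open>1 \<le> liminf a\<close> by simp
    thus "eventually (\<lambda>n. b < a n) sequentially" by (rule less_LiminfD)
  next
    fix b :: ennreal assume "1 < b"
    thus "eventually (\<lambda>n. a n < b) sequentially"
      using a_le by (intro always_eventually allI) (rule le_less_trans)
  qed
  have pow: "(\<lambda>n. a n ^ r) \<longlonglongrightarrow> 1" for r
  proof (induction r)
    case (Suc r)
    show ?case using tendsto_mult_ennreal[OF \<open>a \<longlonglongrightarrow> 1\<close> Suc] by simp
  qed simp
  have partial: "(\<Sum>r<N. ennreal (1 / real r)) \<le> liminf (\<lambda>n. grid_series positivity (h n))" for N
  proof -
    have "(\<lambda>n. \<Sum>r<N. ennreal (1 / real r) * a n ^ r) \<longlonglongrightarrow> (\<Sum>r<N. ennreal (1 / real r) * 1)"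
      by (intro tendsto_sum ennreal_tendsto_cmult pow) auto
    hence "(\<Sum>r<N. ennreal (1 / real r) * 1) = liminf (\<lambda>n. \<Sum>r<N. ennreal (1 / real r) * a n ^ r)"
      by (intro lim_imp_Liminf[symmetric]) auto
    also have "\<dots> \<le> liminf (\<lambda>n. grid_series positivity (h n))"
      unfolding grid_series_positivity[OF h(1)] a_def[symmetric]
      by (intro Liminf_mono always_eventually allI sum_le_suminf) auto
    finally show ?thesis by simp
  qed
  have "(\<Sum>r. ennreal (1 / real r)) = \<infinity>"
  proof (rule ccontr)
    assume "(\<Sum>r. ennreal (1 / real r)) \<noteq> \<infinity>"
    hence "summable (\<lambda>r. 1 / real r)"
      by (intro summable_suminf_not_top) auto
    thus False using not_summable_harmonic[where 'a = real] by (simp add: inverse_eq_divide)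
  qed
  moreover have "(\<Sum>r. ennreal (1 / real r)) \<le> liminf (\<lambda>n. grid_series positivity (h n))"
    using partial by (intro suminf_le_const) auto
  ultimately have top: "liminf (\<lambda>n. grid_series positivity (h n)) = \<infinity>"
    by (simp add: top_unique)
  show ?thesis
  proof (rule order_tendstoI)
    fix b :: ennreal assume "b < \<infinity>"
    hence "b < liminf (\<lambda>n. grid_series positivity (h n))" using top by simp
    thus "eventually (\<lambda>n. b < grid_series positivity (h n)) sequentially" by (rule less_LiminfD)
  qed auto
qed

text \<open>For some \<open>t > 0\<close> the process fails, with probability \<open>1 - P B > 0\<close>, to be positive anywhere in
  \<open>[0, t]\<close>. There the first passage on any grid comes after \<open>t\<close>, so the transform is at most
  \<open>exp (- t)\<close>, whatever the mesh. The constant \<open>c\<close> collects both cases.\<close>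

lemma grid_series_bounded:
  assumes irreg: "\<not> regular_for_positive_half_line M X"
  obtains C where "C < \<infinity>" "\<And>h. h > 0 \<Longrightarrow> grid_series positivity h \<le> C"
proof -
  have "\<exists>n. prob (positive_by (1 / real (Suc n))) < 1"
  proof (rule ccontr)
    assume "\<not> ?thesis"
    hence "prob (positive_by (1 / real (Suc n))) = 1" for n
      by (metis measure_le_1 less_le prob_le_1)
    hence "AE \<omega> in M. \<forall>n. \<omega> \<in> positive_by (1 / real (Suc n))"
      using sets_positive_by by (subst AE_all_countable) (simp add: AE_in_set_eq_1)
    hence "AE \<omega> in M. \<omega> \<in> (\<Inter>n. positive_by (1 / real (Suc n)))"
      by eventually_elim auto
    moreover have "(\<Inter>n. positive_by (1 / real (Suc n))) \<in> sets M"
      by (intro sets.countable_INT) (auto intro!: sets_positive_by)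
    ultimately show False using irreg AE_in_set_eq_1 unfolding regular_iff by blast
  qed
  then obtain m where m: "prob (positive_by (1 / real (Suc m))) < 1" ..
  define t where "t = 1 / real (Suc m)"
  define B where "B = positive_by t"
  have t: "t > 0" by (simp add: t_def)
  have B [measurable]: "B \<in> sets M" and B1: "prob B < 1"
    using m t by (auto simp: B_def t_def simp del: of_nat_Suc intro!: sets_positive_by)
  define c where "c = prob B + exp (- t) * (1 - prob B)"
  have c0: "c \<ge> 0"
    using B1 unfolding c_def by (intro add_nonneg_nonneg mult_nonneg_nonneg) auto
  have "exp (- t) * (1 - prob B) < 1 * (1 - prob B)"
    using t B1 by (intro mult_strict_right_mono) auto
  hence c1: "c < 1" by (simp add: c_def)
  have a_le: "(\<integral>\<^sup>+\<omega>. passage_transform (exp (- h)) (increments h \<omega>) \<partial>M) \<le> ennreal c" if h: "h > 0" for h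
  proof -
    have "(\<integral>\<^sup>+\<omega>. passage_transform (exp (- h)) (increments h \<omega>) \<partial>M)
        \<le> (\<integral>\<^sup>+\<omega>. indicator B \<omega> + ennreal (exp (- t)) * indicator (space M - B) \<omega> \<partial>M)"
    proof (rule nn_integral_mono)
      fix \<omega> assume \<omega>: "\<omega> \<in> space M"
      show "passage_transform (exp (- h)) (increments h \<omega>)
          \<le> indicator B \<omega> + ennreal (exp (- t)) * indicator (space M - B) \<omega>"
      proof (cases "\<omega> \<in> B")
        case True
        thus ?thesis
          using passage_transform_le[of "exp (- h)" "increments h \<omega>" 0] h by simp
      next
        case False
        have "passage_transform (exp (- h)) (increments h \<omega>) \<le> ennreal (exp (- t))"
        proof (cases "\<exists>k. first_passage (increments h \<omega>) k")
          case True
          then obtain k where k: "first_passage (increments h \<omega>) k" ..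
          hence "X (real k * h) \<omega> > 0"
            by (simp add: first_passage_def psum_increments[OF \<omega>])
          hence "real k * h > t"
            using False \<omega> h unfolding B_def positive_by_def by force
          hence "exp (- h) ^ k \<le> exp (- t)"
            by (simp add: exp_of_nat_mult[symmetric])
          thus ?thesis unfolding passage_transform_eq[OF k] by (rule ennreal_leI)
        qed (simp add: passage_transform_def)
        thus ?thesis using False \<omega> by simp
      qed
    qed
    also have "\<dots> = emeasure M B + ennreal (exp (- t)) * emeasure M (space M - B)"
      by (subst nn_integral_add) (auto simp: nn_integral_cmult)
    also have "\<dots> = ennreal c"
      using B1 by (simp add: emeasure_eq_measure prob_compl c_def ennreal_mult)
    finally show ?thesis .
  qed
  define C where "C = (\<Sum>r. ennreal (1 / real r) * ennreal c ^ r)"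
  have "C \<le> (\<Sum>r. ennreal (c ^ r))"
    unfolding C_def
  proof (intro suminf_le allI)
    fix r
    have "1 / real r * c ^ r \<le> 1 * c ^ r"
      using c0 by (intro mult_right_mono) (auto simp: divide_le_eq)
    thus "ennreal (1 / real r) * ennreal c ^ r \<le> ennreal (c ^ r)"
      using c0 by (simp add: ennreal_power ennreal_mult[symmetric] ennreal_leI)
  qed auto
  also have "\<dots> = ennreal (1 / (1 - c))"
    using c0 c1 by (intro suminf_ennreal_eq geometric_sums) auto
  finally have "C < \<infinity>" by (rule le_less_trans) simp
  moreover have "grid_series positivity h \<le> C" if h: "h > 0" for h
    unfolding grid_series_positivity[OF h] C_def
    using a_le[OF h] by (intro suminf_le allI mult_left_mono power_mono) auto
  ultimately show ?thesis using that by blast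
qed

lemma rogozin_criterion:
  "regular_for_positive_half_line M X \<longleftrightarrow>
    (\<integral>\<^sup>+ t \<in> {0<..1}. ennreal (1 / t * prob {\<omega> \<in> space M. X t \<omega> > 0}) \<partial>lborel) = \<infinity>"
proof -
  have "(\<integral>\<^sup>+ t \<in> {0<..1}. ennreal (1 / t * prob {\<omega> \<in> space M. X t \<omega> > 0}) \<partial>lborel)
      = (\<integral>\<^sup>+ t \<in> {0<..1}. ennreal (1 / t * positivity t) \<partial>lborel)"
    by (intro nn_integral_cong) (auto simp: positivity_def indicator_def)
  also have "\<dots> = \<infinity> \<longleftrightarrow> (\<integral>\<^sup>+t\<in>{0<..}. ennreal (exp (- t) * positivity t / t) \<partial>lborel) = \<infinity>"
    by (rule exp_weight_infinite_iff[symmetric]) (auto simp: measurable_positivity positivity_bounds)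
  also have "\<dots> \<longleftrightarrow> regular_for_positive_half_line M X"
  proof
    assume reg: "regular_for_positive_half_line M X"
    show "(\<integral>\<^sup>+t\<in>{0<..}. ennreal (exp (- t) * positivity t / t) \<partial>lborel) = \<infinity>"
    proof (rule exp_weight_infinite_if_grid_series_diverges[OF measurable_positivity positivity_bounds(1)])
      fix u :: real assume u: "0 < u" "u \<le> 1"
      have "(\<lambda>n. 1 / real (Suc n) * u) \<longlonglongrightarrow> 0 * u"
        by (intro tendsto_intros LIMSEQ_Suc[OF lim_1_over_n])
      thus "(\<lambda>n. grid_series positivity (1 / real (Suc n) * u)) \<longlonglongrightarrow> \<infinity>"
        using u by (intro grid_series_tendsto_infinity[OF reg]) auto
    qed
  next
    assume inf: "(\<integral>\<^sup>+t\<in>{0<..}. ennreal (exp (- t) * positivity t / t) \<partial>lborel) = \<infinity>"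
    show "regular_for_positive_half_line M X"
    proof (rule ccontr)
      assume "\<not> ?thesis"
      then obtain C where C: "C < \<infinity>" "\<And>h. h > 0 \<Longrightarrow> grid_series positivity h \<le> C"
        using grid_series_bounded by blast
      have "(\<integral>\<^sup>+t\<in>{0<..}. ennreal (exp (- t) * positivity t / t) \<partial>lborel) \<le> C"
        by (rule exp_weight_le_grid_series_bound[OF measurable_positivity positivity_bounds(1) C(2)])
      with C(1) inf show False by simp
    qed
  qed
  finally show ?thesis by blast
qed

end

theorem theorem6:
  fixes M :: "'a measure" and X :: "real \<Rightarrow> 'a \<Rightarrow> real"
  assumes "levy_process M X"
  shows "regular_for_positive_half_line M X \<longleftrightarrow>
    (\<integral>\<^sup>+ t \<in> {0<..1}. ennreal (1 / t * measure M {\<omega> \<in> space M. X t \<omega> > 0}) \<partial>lborel) = \<infinity>"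
  using levy_process.rogozin_criterion[OF assms] .

end
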